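(* Let $f:\mathbb{R}^n\to\mathbb{R}$ be convex and $L$-smooth ($L>0$), let $\Psi:\mathbb{R}^n\to\mathbb{R}\cup\{+\infty\}$ be closed, proper and convex, let $F=f+\Psi$, and suppose $F$ attains its minimum at a fixed point $\mathbf{x}^*$. Then the points $\mathbf{x}_k$ generated from $\mathbf{x}_0\in\mathbb{R}^n$ by the idealized algorithm described in the context satisfy, for all $k\ge1$, $$F(\mathbf{x}_k)-F(\mathbf{x}^* )\le\frac{2\left(L\|\mathbf{x}_0-\mathbf{x}^*\|^2+F(\mathbf{x}_0)-F(\mathbf{x}^* )\right)}{k(k+1)}.$$
   Context: $f$ is $L$-smooth if it is differentiable and $|f(\mathbf{x})-f(\mathbf{y})-\nabla f(\mathbf{y})^T(\mathbf{x}-\mathbf{y})|\le (L/2)\|\mathbf{x}-\mathbf{y}\|^2$ for all $\mathbf{x},\mathbf{y}$. For $t>0$, $\mathrm{prox}_{t\Psi}(\mathbf{x})=\operatorname{argmin}_{\mathbf{z}}\{\Psi(\mathbf{z})+\|\mathbf{x}-\mathbf{z}\|^2/(2t)\}$, and $G_t(\mathbf{x})=t^{-1}(\mathbf{x}-\mathrm{prox}_{t\Psi}(\mathbf{x}-t\nabla f(\mathbf{x})))$. Idealized algorithm (non-strongly convex and nonconvex case). Set $\mathbf{z}_0=\mathbf{x}_0$, and let $\mathcal{M}_1$ be any affine subspace containing $\mathbf{z}_0+\mathrm{span}\{G_{1/L}(\mathbf{z}_0)\}$. For $k=1,2,\ldots$: (1) $\mathbf{y}_k=\operatorname{argmin}\{\|\mathbf{y}-\mathbf{x}^*\|^2:\mathbf{y}\in\mathcal{M}_k\}$.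 (2) $\mathbf{x}_k\in\operatorname{argmin}\{F(\mathbf{x}):\mathbf{x}\in\mathcal{M}_k\}$ (a minimizer is assumed to exist). (3) $\mathbf{z}_k$ is any point of $\mathcal{M}_k$ with $G_{1/L}(\mathbf{z}_k)^T(\mathbf{y}_k-\mathbf{z}_k)\ge0$ and $-G_{1/L}(\mathbf{z}_k)^T(\mathbf{x}_k-\mathbf{z}_k)\le0$. (4) $\mathcal{M}_{k+1}$ is any affine subspace containing $\{\mathbf{z}_k+\mathrm{span}\{G_{1/L}(\mathbf{z}_k)\}\}\cup\{\mathbf{y}_k+\mathrm{span}\{G_{1/L}(\mathbf{z}_k)\}\}\cup\{\mathbf{x}_k+\mathrm{span}\{G_{1/L}(\mathbf{x}_k)\}\}$. *)

theory Defs
  imports "HOL-Analysis.Analysis"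
begin

definition grad :: "('a::euclidean_space \<Rightarrow> real) \<Rightarrow> 'a \<Rightarrow> 'a" where
  "grad f x = (THE g. GDERIV f x :> g)"

definition L_smooth :: "real \<Rightarrow> ('a::euclidean_space \<Rightarrow> real) \<Rightarrow> bool" where
  "L_smooth L f \<longleftrightarrow>
     (\<forall>x. f differentiable (at x)) \<and>
     (\<forall>x y. \<bar>f x - f y - grad f y \<bullet> (x - y)\<bar> \<le> (L / 2) * (norm (x - y))\<^sup>2)"

text \<open>
  Closedness and convexity of an extended-real-valued function are understood, as usual in convex
  analysis, as closedness and convexity of its epigraph. The epigraph and convexity notions of
  the library only cover real-valued functions.
\<close>

definition epi :: "('a \<Rightarrow> ereal) \<Rightarrow> ('a \<times> real) set" where
  "epi \<Psi> = {(x, r). \<Psi> x \<le> ereal r}"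

definition closed_fun :: "('a::euclidean_space \<Rightarrow> ereal) \<Rightarrow> bool" where
  "closed_fun \<Psi> \<longleftrightarrow> closed (epi \<Psi>)"

definition convex_fun :: "('a::euclidean_space \<Rightarrow> ereal) \<Rightarrow> bool" where
  "convex_fun \<Psi> \<longleftrightarrow> convex (epi \<Psi>)"

text \<open>The first conjunct also expresses that the codomain is the reals extended by plus infinity.\<close>

definition proper_fun :: "('a \<Rightarrow> ereal) \<Rightarrow> bool" where
  "proper_fun \<Psi> \<longleftrightarrow> (\<forall>x. \<Psi> x \<noteq> -\<infinity>) \<and> (\<exists>x. \<Psi> x \<noteq> \<infinity>)"

text \<open>
  The minimizer is unique when \<open>\<Psi>\<close> is closed, proper and convex and \<open>t > 0\<close>, so the choice
  made by \<open>arg_min\<close> is then immaterial.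
\<close>

definition prox :: "real \<Rightarrow> ('a::euclidean_space \<Rightarrow> ereal) \<Rightarrow> 'a \<Rightarrow> 'a" where
  "prox t \<Psi> x = (ARG_MIN (\<lambda>z. \<Psi> z + ereal ((norm (x - z))\<^sup>2 / (2 * t))) z. True)"

definition grad_map ::
  "real \<Rightarrow> ('a::euclidean_space \<Rightarrow> real) \<Rightarrow> ('a \<Rightarrow> ereal) \<Rightarrow> 'a \<Rightarrow> 'a" where
  "grad_map t f \<Psi> x = (1 / t) *\<^sub>R (x - prox t \<Psi> (x - t *\<^sub>R grad f x))"

definition composite :: "('a \<Rightarrow> real) \<Rightarrow> ('a \<Rightarrow> ereal) \<Rightarrow> 'a \<Rightarrow> ereal" where
  "composite f \<Psi> x = ereal (f x) + \<Psi> x"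

text \<open>
  The idealized algorithm is nondeterministic: the affine subspaces, the minimizers \<open>x k\<close> and the
  points \<open>z k\<close> may be chosen freely subject to the stated conditions. It is therefore rendered as
  a predicate on its traces, whose entries \<open>M 0\<close> and \<open>y 0\<close> are unused.
\<close>

definition idealized_algorithm ::
  "real \<Rightarrow> ('a::euclidean_space \<Rightarrow> real) \<Rightarrow> ('a \<Rightarrow> ereal) \<Rightarrow> 'a \<Rightarrow>
   (nat \<Rightarrow> 'a set) \<Rightarrow> (nat \<Rightarrow> 'a) \<Rightarrow> (nat \<Rightarrow> 'a) \<Rightarrow> (nat \<Rightarrow> 'a) \<Rightarrow> bool" where
  "idealized_algorithm L f \<Psi> xstar M x y z \<longleftrightarrow>
     (let F = composite f \<Psi>; G = grad_map (1 / L) f \<Psi> in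
        z 0 = x 0 \<and>
        affine (M 1) \<and> (+) (z 0) ` span {G (z 0)} \<subseteq> M 1 \<and>
        (\<forall>k\<ge>1.
           is_arg_min (\<lambda>v. (norm (v - xstar))\<^sup>2) (\<lambda>v. v \<in> M k) (y k) \<and>
           is_arg_min F (\<lambda>v. v \<in> M k) (x k) \<and>
           z k \<in> M k \<and>
           G (z k) \<bullet> (y k - z k) \<ge> 0 \<and>
           - (G (z k) \<bullet> (x k - z k)) \<le> 0 \<and>
           affine (M (Suc k)) \<and>
           (+) (z k) ` span {G (z k)} \<union> (+) (y k) ` span {G (z k)} \<union> (+) (x k) ` span {G (x k)}
             \<subseteq> M (Suc k)))"

end

theory Submission imports Defs begin

text \<open>
  Write \<open>G = G\<^bsub>1/L\<^esub>\<close> and \<open>u\<^sup>+ = u - G u / L\<close>. For all \<open>u\<close> and \<open>v\<close> one has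
  \<open>F u\<^sup>+ + G u \<bullet> (v - u) + \<parallel>G u\<parallel>\<^sup>2 / (2 L) \<le> F v\<close>. With \<open>u = z\<^sub>k\<close>, taking \<open>v = x\<^sup>*\<close> and \<open>v = x\<^sub>k\<close>,
  and comparing \<open>y\<^bsub>k+1\<^esub>\<close> with \<open>y\<^sub>k - t G z\<^sub>k\<close> for \<open>t = (k + 2) / (2 L)\<close>, shows that
  \<open>L \<parallel>y\<^sub>k - x\<^sup>*\<parallel>\<^sup>2 + (k + 1)\<^sup>2 / 2 * (F x\<^sub>k - F x\<^sup>*)\<close> does not increase. Setting \<open>y\<^sub>0 = x\<^sub>0\<close>, the
  coefficient of \<open>F x\<^sub>0 - F x\<^sup>*\<close> in the first step is zero, so that \<open>F x\<^sub>0\<close> may even be infinite.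
\<close>

section \<open>First-order inequalities from convexity and smoothness\<close>

text \<open>Divide by \<open>s\<close> and let \<open>s\<close> tend to 0 from above. This turns
  comparisons along a segment into first-order inequalities.\<close>

lemma nonneg_linear_term:
  fixes a b :: real
  assumes "\<And>s. 0 < s \<Longrightarrow> s < 1 \<Longrightarrow> 0 \<le> s * a + s\<^sup>2 * b"
  shows "0 \<le> a"
proof -
  have "((\<lambda>s. a + s * b) \<longlongrightarrow> a + 0 * b) (at_right 0)"
    by (intro tendsto_intros)
  moreover have "eventually (\<lambda>s. 0 \<le> a + s * b) (at_right 0)"
    unfolding eventually_at_right[OF zero_less_one]
  proof (intro exI[of _ 1] conjI allI impI)
    fix s :: real assume s: "0 < s" "s < 1"
    have "0 \<le> s * (a + s * b)"
      using assms[OF s] by (simp add: algebra_simps power2_eq_square)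
    then show "0 \<le> a + s * b" using s by (simp add: zero_le_mult_iff)
  qed simp
  ultimately show ?thesis
    using tendsto_lowerbound by fastforce
qed

lemma norm_diff_scaleR_squared:
  fixes a b :: "'a::real_inner"
  shows "(norm (a - s *\<^sub>R b))\<^sup>2 = (norm a)\<^sup>2 - 2 * s * (a \<bullet> b) + s\<^sup>2 * (norm b)\<^sup>2"
  unfolding power2_norm_eq_inner
  by (simp add: inner_diff inner_commute[of b a] power2_eq_square right_diff_distrib)

text \<open>On the segment from \<open>u\<close> to \<open>v\<close>, the chord bounds
  \<open>f\<close> from above and one half of \<open>L_smooth\<close> bounds it from below. The
  error is of order \<open>s\<^sup>2\<close>, so \<open>nonneg_linear_term\<close> removes
  it.\<close>

lemma convex_L_smooth_above_tangent:
  assumes "convex_on UNIV f" "L_smooth L f"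
  shows "f u + grad f u \<bullet> (v - u) \<le> f v"
proof -
  have "0 \<le> f v - f u - grad f u \<bullet> (v - u)"
  proof (rule nonneg_linear_term)
    fix s :: real assume s: "0 < s" "s < 1"
    let ?w = "u + s *\<^sub>R (v - u)"
    have "\<bar>f ?w - f u - grad f u \<bullet> (?w - u)\<bar> \<le> (L / 2) * (norm (?w - u))\<^sup>2"
      using assms(2) unfolding L_smooth_def by blast
    then have "\<bar>f ?w - f u - s * (grad f u \<bullet> (v - u))\<bar> \<le> (L / 2) * (s\<^sup>2 * (norm (v - u))\<^sup>2)"
      by (simp add: power_mult_distrib)
    then have "f u + s * (grad f u \<bullet> (v - u)) - (L / 2) * (s\<^sup>2 * (norm (v - u))\<^sup>2) \<le> f ?w"
      by linarith
    moreover have "f ?w \<le> (1 - s) * f u + s * f v"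
    proof -
      have "?w = (1 - s) *\<^sub>R u + s *\<^sub>R v" by (simp add: algebra_simps)
      then show ?thesis using convex_onD[OF assms(1), of s u v] s by simp
    qed
    ultimately show "0 \<le> s * (f v - f u - grad f u \<bullet> (v - u)) + s\<^sup>2 * ((L / 2) * (norm (v - u))\<^sup>2)"
      by (simp add: algebra_simps)
  qed
  then show ?thesis by simp
qed

section \<open>Existence and optimality of the proximal point\<close>

lemma proper_fun_real:
  assumes "proper_fun \<Psi>" "\<Psi> x \<noteq> \<infinity>"
  obtains r where "\<Psi> x = ereal r"
  using assms unfolding proper_fun_def by (cases "\<Psi> x") auto

text \<open>By the parallelogram law, the first components of a minimizing sequence in the epigraph
  form a Cauchy sequence.\<close>

lemma prox_minimizer_exists:
  fixes \<Psi> :: "'a::euclidean_space \<Rightarrow> ereal"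
  assumes "c > 0" and "closed_fun \<Psi>" "proper_fun \<Psi>" "convex_fun \<Psi>"
    and bounded: "\<And>z. ereal m \<le> \<Psi> z + ereal (c * (norm (w - z))\<^sup>2)"
  shows "\<exists>p. is_arg_min (\<lambda>z. \<Psi> z + ereal (c * (norm (w - z))\<^sup>2)) (\<lambda>_. True) p"
proof -
  \<comment> \<open>On the epigraph the extended-real objective becomes the real function
    \<open>\<phi>\<close>, so its infimum is one of a set of reals.\<close>
  define \<phi> where "\<phi> = (\<lambda>q::'a \<times> real. snd q + c * (norm (w - fst q))\<^sup>2)"
  define \<mu> where "\<mu> = Inf (\<phi> ` epi \<Psi>)"
  obtain x0 where "\<Psi> x0 \<noteq> \<infinity>" using assms(3) unfolding proper_fun_def by blast
  then obtain r0 where "\<Psi> x0 = ereal r0" by (rule proper_fun_real[OF assms(3)])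
  then have "(x0, r0) \<in> epi \<Psi>" unfolding epi_def by simp
  then have ne: "\<phi> ` epi \<Psi> \<noteq> {}" by blast
  have "m \<le> \<phi> q" if q: "q \<in> epi \<Psi>" for q
  proof -
    have "\<Psi> (fst q) \<le> ereal (snd q)" using q unfolding epi_def by auto
    then have "\<Psi> (fst q) + ereal (c * (norm (w - fst q))\<^sup>2) \<le> ereal (\<phi> q)"
      unfolding \<phi>_def plus_ereal.simps(1)[symmetric] by (rule add_right_mono)
    then show ?thesis using bounded[of "fst q"] order_trans by fastforce
  qed
  then have bdd: "bdd_below (\<phi> ` epi \<Psi>)" by (auto intro!: bdd_belowI)
  have lower: "\<mu> \<le> \<phi> q" if "q \<in> epi \<Psi>" for q
    unfolding \<mu>_def using bdd that by (simp add: cInf_lower)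
  have "\<exists>q \<in> epi \<Psi>. \<phi> q < \<mu> + 1 / real (Suc n)" for n
    using cInf_lessD[OF ne, of "\<mu> + 1 / real (Suc n)"] unfolding \<mu>_def by auto
  then obtain q where q: "\<And>n. q n \<in> epi \<Psi>" "\<And>n. \<phi> (q n) < \<mu> + 1 / real (Suc n)"
    by metis
  define e where "e = (\<lambda>n. 1 / real (Suc n))"
  have q_lt: "\<phi> (q n) < \<mu> + e n" for n using q(2) unfolding e_def .
  have e0: "e \<longlonglongrightarrow> 0" unfolding e_def by (rule LIMSEQ_Suc[OF lim_1_over_n])
  have est: "c * (norm (fst (q i) - fst (q j)))\<^sup>2 \<le> 2 * (e i + e j)" for i j
  proof -
    define mid where "mid = (1/2) *\<^sub>R q i + (1/2) *\<^sub>R q j"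
    have "mid \<in> epi \<Psi>"
      unfolding mid_def using assms(4) q(1) unfolding convex_fun_def by (intro convexD) auto
    then have "\<mu> \<le> \<phi> mid" by (rule lower)
    also have "\<phi> mid = (\<phi> (q i) + \<phi> (q j)) / 2 - c * (norm (fst (q i) - fst (q j)))\<^sup>2 / 4"
      unfolding \<phi>_def mid_def power2_norm_eq_inner
      by (simp add: inner_simps inner_commute field_simps)
    finally show ?thesis using q_lt[of i] q_lt[of j] by argo
  qed
  have "Cauchy (\<lambda>n. fst (q n))"
    unfolding Cauchy_def
  proof (intro allI impI)
    fix \<epsilon> :: real assume "\<epsilon> > 0"
    then have "c * \<epsilon>\<^sup>2 / 4 > 0" using assms(1) by simp
    with e0 have "eventually (\<lambda>n. e n < c * \<epsilon>\<^sup>2 / 4) sequentially"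
      by (rule order_tendstoD)
    then obtain N where N: "\<And>n. n \<ge> N \<Longrightarrow> e n < c * \<epsilon>\<^sup>2 / 4"
      unfolding eventually_sequentially by blast
    have "dist (fst (q i)) (fst (q j)) < \<epsilon>" if "i \<ge> N" "j \<ge> N" for i j
    proof -
      have "c * (norm (fst (q i) - fst (q j)))\<^sup>2 < c * \<epsilon>\<^sup>2"
        using est[of i j] N[OF that(1)] N[OF that(2)] by argo
      then have "(norm (fst (q i) - fst (q j)))\<^sup>2 < \<epsilon>\<^sup>2" using assms(1) by simp
      then show ?thesis using \<open>\<epsilon> > 0\<close> by (simp add: dist_norm power_less_imp_less_base)
    qed
    then show "\<exists>N. \<forall>i\<ge>N. \<forall>j\<ge>N. dist (fst (q i)) (fst (q j)) < \<epsilon>" by blast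
  qed
  then obtain p where p: "(\<lambda>n. fst (q n)) \<longlonglongrightarrow> p"
    using Cauchy_convergent_iff convergent_def by blast
  \<comment> \<open>So far only the first components converge. The second ones are
    \<open>\<phi> (q n)\<close> minus the quadratic term, hence converge too, and closedness keeps
    the limit in the epigraph.\<close>
  have "(\<lambda>n. \<phi> (q n)) \<longlonglongrightarrow> \<mu>"
  proof (rule tendsto_sandwich[of "\<lambda>_. \<mu>" _ _ "\<lambda>n. \<mu> + e n"])
    show "(\<lambda>n. \<mu> + e n) \<longlonglongrightarrow> \<mu>" using tendsto_add[OF tendsto_const e0, of \<mu>] by simp
    show "\<forall>\<^sub>F n in sequentially. \<phi> (q n) \<le> \<mu> + e n"
      using q_lt by (simp add: less_imp_le)
  qed (use lower q(1) in auto)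
  then have "(\<lambda>n. \<phi> (q n) - c * (norm (w - fst (q n)))\<^sup>2) \<longlonglongrightarrow> \<mu> - c * (norm (w - p))\<^sup>2"
    by (intro tendsto_intros p)
  then have "(\<lambda>n. snd (q n)) \<longlonglongrightarrow> \<mu> - c * (norm (w - p))\<^sup>2" by (simp add: \<phi>_def)
  with p have "q \<longlonglongrightarrow> (p, \<mu> - c * (norm (w - p))\<^sup>2)" using tendsto_Pair by fastforce
  then have "(p, \<mu> - c * (norm (w - p))\<^sup>2) \<in> epi \<Psi>"
    using assms(2) q(1) closed_sequentially unfolding closed_fun_def by blast
  then have "\<Psi> p \<le> ereal (\<mu> - c * (norm (w - p))\<^sup>2)" unfolding epi_def by simp
  then have p_le: "\<Psi> p + ereal (c * (norm (w - p))\<^sup>2) \<le> ereal \<mu>"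
    using add_right_mono[of "\<Psi> p" _ "ereal (c * (norm (w - p))\<^sup>2)"] by fastforce
  have "ereal \<mu> \<le> \<Psi> z + ereal (c * (norm (w - z))\<^sup>2)" for z
  proof (cases "\<Psi> z = \<infinity>")
    case False
    then obtain r where r: "\<Psi> z = ereal r" by (rule proper_fun_real[OF assms(3)])
    then have "(z, r) \<in> epi \<Psi>" unfolding epi_def by simp
    from lower[OF this] show ?thesis using r unfolding \<phi>_def by simp
  qed simp
  with p_le have "is_arg_min (\<lambda>z. \<Psi> z + ereal (c * (norm (w - z))\<^sup>2)) (\<lambda>_. True) p"
    unfolding is_arg_min_linorder by (blast intro: order_trans)
  then show ?thesis by blast
qed

text \<open>Comparing the minimizer \<open>p\<close> with
  \<open>(1 - s) *\<^sub>R p + s *\<^sub>R v\<close>, using convexity and letting \<open>s\<close>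
  tend to 0 leaves the linear terms: \<open>(1 / t) *\<^sub>R (w - p)\<close> is a subgradient of
  \<open>\<Psi>\<close> at \<open>p\<close>.\<close>

lemma prox_variational_inequality:
  fixes \<Psi> :: "'a::euclidean_space \<Rightarrow> ereal"
  assumes "t > 0" "closed_fun \<Psi>" "proper_fun \<Psi>" "convex_fun \<Psi>"
    and bounded: "\<And>z. ereal m \<le> \<Psi> z + ereal ((norm (w - z))\<^sup>2 / (2 * t))"
  obtains r where "\<Psi> (prox t \<Psi> w) = ereal r"
    "\<And>v. ereal (r + (1 / t) * ((w - prox t \<Psi> w) \<bullet> (v - prox t \<Psi> w))) \<le> \<Psi> v"
proof -
  define p where "p = prox t \<Psi> w"
  \<comment> \<open>\<open>prox\<close> is defined by choice, so it is a minimizer once one exists;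
    \<open>bounded\<close> ensures this.\<close>
  have "\<exists>p. is_arg_min (\<lambda>z. \<Psi> z + ereal ((norm (w - z))\<^sup>2 / (2 * t))) (\<lambda>_. True) p"
    using prox_minimizer_exists[of "1 / (2 * t)" \<Psi> m w] assms by simp
  then have "is_arg_min (\<lambda>z. \<Psi> z + ereal ((norm (w - z))\<^sup>2 / (2 * t))) (\<lambda>_. True) p"
    unfolding p_def prox_def arg_min_def by (rule someI_ex)
  then have min: "\<Psi> p + ereal ((norm (w - p))\<^sup>2 / (2 * t)) \<le> \<Psi> v + ereal ((norm (w - v))\<^sup>2 / (2 * t))"
    for v unfolding is_arg_min_linorder by blast
  obtain v0 where "\<Psi> v0 \<noteq> \<infinity>" using assms(3) unfolding proper_fun_def by blast
  then have "\<Psi> p \<noteq> \<infinity>" using min[of v0] by auto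
  then obtain r where r: "\<Psi> p = ereal r" by (rule proper_fun_real[OF assms(3)])
  have "ereal (r + (1 / t) * ((w - p) \<bullet> (v - p))) \<le> \<Psi> v" for v
  proof (cases "\<Psi> v = \<infinity>")
    case False
    then obtain b where b: "\<Psi> v = ereal b" by (rule proper_fun_real[OF assms(3)])
    have "0 \<le> b - r - (1 / t) * ((w - p) \<bullet> (v - p))"
    proof (rule nonneg_linear_term)
      fix s :: real assume s: "0 < s" "s < 1"
      let ?v = "(1 - s) *\<^sub>R p + s *\<^sub>R v"
      have "(p, r) \<in> epi \<Psi>" "(v, b) \<in> epi \<Psi>" using r b unfolding epi_def by auto
      then have "(1 - s) *\<^sub>R (p, r) + s *\<^sub>R (v, b) \<in> epi \<Psi>"
        using assms(4) s unfolding convex_fun_def by (intro convexD) auto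
      then have "\<Psi> ?v \<le> ereal ((1 - s) * r + s * b)" unfolding epi_def by simp
      then have "\<Psi> ?v + ereal ((norm (w - ?v))\<^sup>2 / (2 * t))
          \<le> ereal ((1 - s) * r + s * b) + ereal ((norm (w - ?v))\<^sup>2 / (2 * t))"
        by (rule add_right_mono)
      with min[of ?v] have "r + (norm (w - p))\<^sup>2 / (2 * t)
          \<le> (1 - s) * r + s * b + (norm (w - ?v))\<^sup>2 / (2 * t)"
        using r order_trans by fastforce
      moreover have "(norm (w - ?v))\<^sup>2 / (2 * t) = (norm (w - p))\<^sup>2 / (2 * t)
          - s * ((1 / t) * ((w - p) \<bullet> (v - p))) + s\<^sup>2 * ((norm (v - p))\<^sup>2 / (2 * t))"
      proof -
        have "w - ?v = (w - p) - s *\<^sub>R (v - p)" by (simp add: algebra_simps)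
        then show ?thesis
          using assms(1) by (simp only: norm_diff_scaleR_squared) (simp add: field_simps)
      qed
      ultimately show "0 \<le> s * (b - r - (1 / t) * ((w - p) \<bullet> (v - p)))
          + s\<^sup>2 * ((norm (v - p))\<^sup>2 / (2 * t))"
        by (simp only: ring_distribs mult_1)
    qed
    then show ?thesis using b by simp
  qed simp
  with r show ?thesis using that unfolding p_def by blast
qed

section \<open>Estimates for a single step: gradient mapping and potential\<close>

text \<open>Three bounds add up: the subgradient inequality of \<open>\<Psi>\<close> at the proximal
  point \<open>p\<close>, the tangent bound of \<open>f\<close> at \<open>u\<close>, and the
  smoothness upper bound of \<open>f\<close> at \<open>p\<close>.\<close>

lemma grad_map_step_inequality:
  fixes f :: "'a::euclidean_space \<Rightarrow> real"
  assumes "L > 0" "convex_on UNIV f" "L_smooth L f"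
    and "closed_fun \<Psi>" "proper_fun \<Psi>" "convex_fun \<Psi>"
    and bounded: "\<And>v. ereal m \<le> composite f \<Psi> v"
  defines "G \<equiv> grad_map (1 / L) f \<Psi>"
  obtains r where "composite f \<Psi> (u - (1 / L) *\<^sub>R G u) = ereal r"
    "\<And>v. ereal (r + G u \<bullet> (v - u) + (norm (G u))\<^sup>2 / (2 * L)) \<le> composite f \<Psi> v"
proof -
  define g where "g = grad f u"
  define w where "w = u - (1 / L) *\<^sub>R g"
  define p where "p = prox (1 / L) \<Psi> w"
  have G: "G u = L *\<^sub>R (u - p)" unfolding G_def grad_map_def p_def w_def g_def by simp
  have p: "p = u - (1 / L) *\<^sub>R G u" using G assms(1) by simp
  have smooth: "f v \<le> f u + g \<bullet> (v - u) + (L / 2) * (norm (v - u))\<^sup>2" for v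
    using assms(3) unfolding L_smooth_def g_def by (smt (verit))
  \<comment> \<open>Completing the square: up to constants, the proximal quadratic is the smoothness
    upper model of \<open>f\<close> around \<open>u\<close>. Thus the lower bound \<open>m\<close>
    of \<open>composite f \<Psi>\<close> carries over to the proximal objective.\<close>
  have quad: "(norm (w - v))\<^sup>2 / (2 * (1 / L))
      = g \<bullet> (v - u) + (L / 2) * (norm (v - u))\<^sup>2 + (norm g)\<^sup>2 / (2 * L)" for v
  proof -
    have "w - v = - ((v - u) + (1 / L) *\<^sub>R g)" by (simp add: w_def)
    then have "norm (w - v) = norm ((v - u) + (1 / L) *\<^sub>R g)" by (simp only: norm_minus_cancel)
    then have "(norm (w - v))\<^sup>2 = (norm (v - u))\<^sup>2 + 2 * (g \<bullet> (v - u)) / L + (norm g)\<^sup>2 / L\<^sup>2"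
      using norm_diff_scaleR_squared[of "v - u" "- (1 / L)" g]
      by (simp add: inner_commute power_divide)
    then show ?thesis using assms(1) by (simp add: field_simps power2_eq_square)
  qed
  have "ereal (m - f u + (norm g)\<^sup>2 / (2 * L)) \<le> \<Psi> v + ereal ((norm (w - v))\<^sup>2 / (2 * (1 / L)))"
    for v
  proof (cases "\<Psi> v = \<infinity>")
    case False
    then obtain b where b: "\<Psi> v = ereal b" by (rule proper_fun_real[OF assms(5)])
    then have "m \<le> f v + b" using bounded[of v] unfolding composite_def by simp
    then have "m - f u + (norm g)\<^sup>2 / (2 * L) \<le> b + (norm (w - v))\<^sup>2 / (2 * (1 / L))"
      using smooth[of v] unfolding quad by linarith
    then show ?thesis using b by simp
  qed simp
  then obtain c where c: "\<Psi> p = ereal c"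
    "\<And>v. ereal (c + L * ((w - p) \<bullet> (v - p))) \<le> \<Psi> v"
    using prox_variational_inequality[of "1 / L" \<Psi> "m - f u + (norm g)\<^sup>2 / (2 * L)" w] assms
    unfolding p_def by auto
  have "ereal (f p + c + G u \<bullet> (v - u) + (norm (G u))\<^sup>2 / (2 * L)) \<le> composite f \<Psi> v" for v
  proof (cases "\<Psi> v = \<infinity>")
    case True
    then show ?thesis unfolding composite_def by simp
  next
    case False
    then obtain b where b: "\<Psi> v = ereal b" by (rule proper_fun_real[OF assms(5)])
    \<comment> \<open>Here \<open>L *\<^sub>R (w - p) = G u - g\<close>, and next
      \<open>v - p = (v - u) + (1 / L) *\<^sub>R G u\<close>.\<close>
    have "L * ((w - p) \<bullet> (v - p)) = (G u - g) \<bullet> (v - p)"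
      unfolding G w_def using assms(1) by (simp add: inner_diff inner_simps algebra_simps)
    also have "\<dots> = G u \<bullet> (v - u) + (norm (G u))\<^sup>2 / L - g \<bullet> (v - u) + g \<bullet> (p - u)"
      unfolding p using assms(1) by (simp add: inner_simps power2_norm_eq_inner algebra_simps)
    finally have "c + G u \<bullet> (v - u) + (norm (G u))\<^sup>2 / L - g \<bullet> (v - u) + g \<bullet> (p - u) \<le> b"
      using c(2)[of v] b by simp
    \<comment> \<open>The upper bound on \<open>f p\<close> costs half of
      \<open>(norm (G u))\<^sup>2 / L\<close>; the other half remains in the claim.\<close>
    moreover have "(L / 2) * (norm (p - u))\<^sup>2 = (norm (G u))\<^sup>2 / (2 * L)"
      unfolding p using assms(1) by (simp add: power_divide power2_eq_square)
    moreover have "f u + g \<bullet> (v - u) \<le> f v"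
      unfolding g_def by (rule convex_L_smooth_above_tangent[OF assms(2,3)])
    ultimately have "f p + c + G u \<bullet> (v - u) + (norm (G u))\<^sup>2 / (2 * L) \<le> f v + b"
      using smooth[of p] by (simp add: field_simps)
    then show ?thesis using b unfolding composite_def by simp
  qed
  moreover have "composite f \<Psi> (u - (1 / L) *\<^sub>R G u) = ereal (f p + c)"
    using c(1) unfolding p[symmetric] composite_def by simp
  ultimately show ?thesis using that by blast
qed

text \<open>Here \<open>a\<close> and \<open>a'\<close> are consecutive displacements \<open>y\<^sub>k - x\<^sup>*\<close>, and \<open>d\<close> and \<open>d'\<close> the
  corresponding values of \<open>F x\<^sub>k - F x\<^sup>*\<close>.\<close>

lemma potential_step:
  fixes a a' g :: "'a::real_inner" and d d' L \<kappa> :: real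
  assumes "L > 0" "\<kappa> \<ge> 0"
    and closer: "\<And>t. norm a' \<le> norm (a - t *\<^sub>R g)"
    and gap: "d' + (norm g)\<^sup>2 / (2 * L) \<le> g \<bullet> a"
    and decrease: "\<kappa> > 0 \<Longrightarrow> d' + (norm g)\<^sup>2 / (2 * L) \<le> d"
  shows "L * (norm a')\<^sup>2 + (\<kappa> + 2)\<^sup>2 / 2 * d' \<le> L * (norm a)\<^sup>2 + \<kappa> * (\<kappa> + 2) / 2 * d"
proof -
  \<comment> \<open>This makes \<open>2 * (L * t) = \<kappa> + 2\<close>, the weight given to
    \<open>gap\<close>. With the weight \<open>\<kappa> * (\<kappa> + 2) / 2\<close> of
    \<open>decrease\<close> it sums to \<open>(\<kappa> + 2)\<^sup>2 / 2\<close>, so all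
    \<open>N\<close> terms cancel.\<close>
  define t where "t = (\<kappa> + 2) / (2 * L)"
  define N where "N = (norm g)\<^sup>2 / (2 * L)"
  have gg: "g \<bullet> g = 2 * L * N" unfolding N_def using assms(1) by (simp add: power2_norm_eq_inner)
  have Lt: "L * t = (\<kappa> + 2) / 2" unfolding t_def using assms(1) by simp
  have "(norm a')\<^sup>2 \<le> (norm (a - t *\<^sub>R g))\<^sup>2" using closer by (simp add: power_mono)
  also have "\<dots> = (norm a)\<^sup>2 - 2 * t * (g \<bullet> a) + t\<^sup>2 * (g \<bullet> g)"
    by (simp add: norm_diff_scaleR_squared inner_commute dot_square_norm)
  finally have "L * (norm a')\<^sup>2 \<le> L * ((norm a)\<^sup>2 - 2 * t * (g \<bullet> a) + t\<^sup>2 * (g \<bullet> g))"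
    using assms(1) by simp
  also have "\<dots> = L * (norm a)\<^sup>2 - 2 * (L * t) * (g \<bullet> a) + 2 * (L * t)\<^sup>2 * N"
    unfolding gg by (simp add: power2_eq_square algebra_simps)
  also have "\<dots> = L * (norm a)\<^sup>2 - (\<kappa> + 2) * (g \<bullet> a) + (\<kappa> + 2)\<^sup>2 / 2 * N"
    unfolding Lt by (simp add: power2_eq_square)
  finally have 1: "L * (norm a')\<^sup>2 \<le> L * (norm a)\<^sup>2 - (\<kappa> + 2) * (g \<bullet> a) + (\<kappa> + 2)\<^sup>2 / 2 * N" .
  have 2: "(\<kappa> + 2) * (d' + N) \<le> (\<kappa> + 2) * (g \<bullet> a)"
    using gap assms(2) unfolding N_def by (intro mult_left_mono) auto
  \<comment> \<open>For \<open>\<kappa> = 0\<close> both sides vanish; otherwise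
    \<open>decrease\<close> applies.\<close>
  have 3: "\<kappa> * (\<kappa> + 2) / 2 * (d' + N) \<le> \<kappa> * (\<kappa> + 2) / 2 * d"
    using decrease assms(2) unfolding N_def
    by (cases "\<kappa> = 0") (auto intro!: mult_left_mono)
  show ?thesis using 1 2 3 by (simp add: power2_eq_square field_simps)
qed

section \<open>Decrease of the potential along a trace and the resulting rate\<close>

theorem corollary7p2:
  fixes f :: "real ^ 'n \<Rightarrow> real"
    and \<Psi> F :: "real ^ 'n \<Rightarrow> ereal"
    and L :: real
    and xstar x0 :: "real ^ 'n"
    and M :: "nat \<Rightarrow> (real ^ 'n) set"
    and x y z :: "nat \<Rightarrow> real ^ 'n"
  assumes "L > 0"
    and "convex_on UNIV f" and "L_smooth L f"
    and "closed_fun \<Psi>" and "proper_fun \<Psi>" and "convex_fun \<Psi>"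
    and "F = composite f \<Psi>"
    and "is_arg_min F (\<lambda>_. True) xstar"
    and "x 0 = x0"
    and "idealized_algorithm L f \<Psi> xstar M x y z"
  shows "\<forall>k\<ge>1. F (x k) - F xstar
           \<le> 2 * (ereal (L * (norm (x0 - xstar))\<^sup>2) + F x0 - F xstar)
              / ereal (real k * (real k + 1))"
proof -
  define G where "G = grad_map (1 / L) f \<Psi>"
  \<comment> \<open>Since \<open>Y 0 = z 0\<close>, the subspace inclusion and the sign condition
    for \<open>Y k\<close> hold at \<open>k = 0\<close> as well, and the induction can start
    there.\<close>
  define Y where "Y = y(0 := x0)"
  note alg = assms(10)[unfolded idealized_algorithm_def Let_def, folded assms(7) G_def]
  have min: "F xstar \<le> F v" for v using assms(8) unfolding is_arg_min_linorder by blast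
  obtain v0 where "\<Psi> v0 \<noteq> \<infinity>" using assms(5) unfolding proper_fun_def by blast
  then have "F v0 \<noteq> \<infinity>" unfolding assms(7) composite_def by simp
  then have "F xstar \<noteq> \<infinity>" using min[of v0] by auto
  moreover have "F v \<noteq> -\<infinity>" for v
    using assms(5) unfolding assms(7) composite_def proper_fun_def by simp
  ultimately obtain m where m: "F xstar = ereal m" by (cases "F xstar") auto
  \<comment> \<open>The finite minimum value \<open>m\<close> is the lower bound that makes the
    proximal points exist.\<close>
  have key: "\<exists>r. F (u - (1 / L) *\<^sub>R G u) = ereal r \<and>
      (\<forall>v. ereal (r + G u \<bullet> (v - u) + (norm (G u))\<^sup>2 / (2 * L)) \<le> F v)" for u
    using grad_map_step_inequality[OF assms(1-6), of m u] min m
    unfolding assms(7) G_def by metis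
  have subspace: "Y k + s *\<^sub>R G (z k) \<in> M (Suc k)" "z k + s *\<^sub>R G (z k) \<in> M (Suc k)" for k s
  proof -
    have span: "s *\<^sub>R G (z k) \<in> span {G (z k)}" by (simp add: span_base span_mul)
    have "(+) (z 0) ` span {G (z 0)} \<subseteq> M 1" "z 0 = x0"
      using alg assms(9) by auto
    moreover have "(+) (z k) ` span {G (z k)} \<subseteq> M (Suc k)" "(+) (y k) ` span {G (z k)} \<subseteq> M (Suc k)"
      if "k \<ge> 1" using alg that by blast+
    ultimately have "(+) (Y k) ` span {G (z k)} \<subseteq> M (Suc k)" "(+) (z k) ` span {G (z k)} \<subseteq> M (Suc k)"
      unfolding Y_def by (cases "k = 0"; simp)+
    with span show "Y k + s *\<^sub>R G (z k) \<in> M (Suc k)" "z k + s *\<^sub>R G (z k) \<in> M (Suc k)"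
      by blast+
  qed
  have x_min: "F (x (Suc k)) \<le> F v" if "v \<in> M (Suc k)" for k v
    using alg that unfolding is_arg_min_linorder by simp
  have y_min: "norm (Y (Suc k) - xstar) \<le> norm (v - xstar)" if "v \<in> M (Suc k)" for k v
  proof -
    have "(norm (y (Suc k) - xstar))\<^sup>2 \<le> (norm (v - xstar))\<^sup>2"
      using alg that unfolding is_arg_min_linorder by simp
    then show ?thesis unfolding Y_def by (simp add: power2_le_iff_abs_le)
  qed
  have x_le: "F (x (Suc k)) \<le> F (z k - (1 / L) *\<^sub>R G (z k))" for k
    using x_min[OF subspace(2)[of k "- (1 / L)"]] by simp
  \<comment> \<open>If \<open>F x0\<close> is infinite, \<open>real_of_ereal\<close> yields
    \<open>d 0 = - m\<close>; this is harmless, as \<open>d 0\<close> enters \<open>step\<close>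
    with factor 0.\<close>
  define d where "d = (\<lambda>k. real_of_ereal (F (x k)) - m)"
  have d: "F (x (Suc k)) = ereal (m + d (Suc k))" for k
  proof -
    obtain r where "F (z k - (1 / L) *\<^sub>R G (z k)) = ereal r" using key by blast
    then show ?thesis using x_le[of k] min[of "x (Suc k)"] m unfolding d_def
      by (cases "F (x (Suc k))") auto
  qed
  have step: "L * (norm (Y (Suc k) - xstar))\<^sup>2 + (real k + 2)\<^sup>2 / 2 * d (Suc k)
      \<le> L * (norm (Y k - xstar))\<^sup>2 + real k * (real k + 2) / 2 * d k" for k
  proof (rule potential_step[OF assms(1), where g = "G (z k)"])
    show "norm (Y (Suc k) - xstar) \<le> norm (Y k - xstar - t *\<^sub>R G (z k))" for t
      using y_min[OF subspace(1)[of k "- t"]] by (simp add: algebra_simps)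
    obtain r where r: "F (z k - (1 / L) *\<^sub>R G (z k)) = ereal r"
      "\<And>v. ereal (r + G (z k) \<bullet> (v - z k) + (norm (G (z k)))\<^sup>2 / (2 * L)) \<le> F v"
      using key by blast
    have le: "m + d (Suc k) \<le> r" using x_le[of k] r(1) d[of k] by simp
    \<comment> \<open>Split \<open>Y k - xstar\<close> at \<open>z k\<close>: this is the part
      towards \<open>Y k\<close>, which is zero for \<open>k = 0\<close>; the other part is bounded
      by \<open>r(2)\<close> at \<open>xstar\<close>.\<close>
    have "0 \<le> G (z k) \<bullet> (Y k - z k)"
      using alg assms(9) unfolding Y_def by (cases "k = 0") auto
    then show "d (Suc k) + (norm (G (z k)))\<^sup>2 / (2 * L) \<le> G (z k) \<bullet> (Y k - xstar)"
      using r(2)[of xstar] le m by (simp add: inner_diff_right)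
    show "d (Suc k) + (norm (G (z k)))\<^sup>2 / (2 * L) \<le> d k" if "real k > 0"
    proof -
      have "k \<ge> 1" using that by simp
      \<comment> \<open>The second sign condition lets the linear term in \<open>r(2)\<close> at
        \<open>x k\<close> be dropped.\<close>
      then have "0 \<le> G (z k) \<bullet> (x k - z k)" using alg by auto
      moreover have "F (x k) = ereal (m + d k)" using d[of "k - 1"] \<open>k \<ge> 1\<close> by simp
      ultimately show ?thesis using r(2)[of "x k"] le by simp
    qed
  qed simp
  have d_nonneg: "0 \<le> d (Suc k)" for k using min[of "x (Suc k)"] m d[of k] by simp
  have potential: "L * (norm (Y (Suc k) - xstar))\<^sup>2 + (real k + 2)\<^sup>2 / 2 * d (Suc k)
      \<le> L * (norm (x0 - xstar))\<^sup>2" for k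
  proof (induction k)
    case 0
    show ?case using step[of 0] by (simp add: Y_def)
  next
    case (Suc k)
    \<comment> \<open>The coefficients match since
      \<open>(k + 1) * (k + 3) \<le> (k + 2)\<^sup>2\<close>.\<close>
    have "real (Suc k) * (real (Suc k) + 2) / 2 * d (Suc k) \<le> (real k + 2)\<^sup>2 / 2 * d (Suc k)"
      by (intro mult_right_mono d_nonneg) (simp add: power2_eq_square algebra_simps)
    then show ?case using step[of "Suc k"] Suc.IH by linarith
  qed
  show ?thesis
  proof (intro allI impI)
    fix k :: nat assume "k \<ge> 1"
    then obtain j where k: "k = Suc j" by (cases k) auto
    have pos: "real k * (real k + 1) > 0" using k by simp
    show "F (x k) - F xstar \<le> 2 * (ereal (L * (norm (x0 - xstar))\<^sup>2) + F x0 - F xstar)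
        / ereal (real k * (real k + 1))"
    proof (cases "F x0")
      case (real r)
      \<comment> \<open>As \<open>k = Suc j\<close>, the potential carries
        \<open>(k + 1)\<^sup>2\<close>, which dominates \<open>k * (k + 1)\<close>; the nonnegative
        \<open>r - m\<close> is then added on the right.\<close>
      have "real k * (real k + 1) / 2 * d k \<le> (real j + 2)\<^sup>2 / 2 * d k"
        unfolding k by (intro mult_right_mono d_nonneg) (simp add: power2_eq_square algebra_simps)
      also have "\<dots> \<le> L * (norm (x0 - xstar))\<^sup>2"
        using potential[of j] assms(1) unfolding k
        by (smt (verit) mult_nonneg_nonneg zero_le_power2)
      also have "\<dots> \<le> L * (norm (x0 - xstar))\<^sup>2 + r - m" using min[of x0] m real by simp
      finally have "real k * (real k + 1) * d k \<le> 2 * (L * (norm (x0 - xstar))\<^sup>2 + r - m)"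
        by simp
      then have "d k \<le> 2 * (L * (norm (x0 - xstar))\<^sup>2 + r - m) / (real k * (real k + 1))"
        unfolding pos_le_divide_eq[OF pos] by (simp only: mult.commute[of "d k"])
      then show ?thesis using real m d[of j] pos unfolding k by simp
    next
      case PInf
      then show ?thesis using m pos by simp
    next
      case MInf
      then show ?thesis using \<open>\<And>v. F v \<noteq> -\<infinity>\<close> by simp
    qed
  qed
qed

end
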